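(* Let $K$ be a field, let $n, m\geq 1$ be integers, and let $f(x_1,\dots,x_m)\in K\langle X\rangle$ be a multilinear polynomial with image $Im(f)$ on $M_n(K)$. Endow $M_n(K)$ with the Vasilovsky $\mathbb{Z}_n$-grading. Then: (1) $Im(f)$ is contained in the set of scalar matrices if and only if $f(a_1,\dots,a_m)=0$ for all homogeneous matrices $a_1,\dots,a_m\in M_n(K)$ satisfying $\sum_{i=1}^m\deg(a_i)\neq 0$ in $\mathbb{Z}_n$. (2) $Im(f)\subseteq sl_n(K)$ if and only if $tr(f(a_1,\dots,a_m))=0$ for all homogeneous matrices $a_1,\dots,a_m\in M_n(K)$ satisfying $\sum_{i=1}^m\deg(a_i)=0$ in $\mathbb{Z}_n$.
   Context: $K\langle X\rangle$ is the free associative $K$-algebra on a countable set $X$ of noncommuting variables. A polynomial $f(x_1,\dots,x_m)\in K\langle X\rangle$ is multilinear if $f=\sum_{\sigma\in S_m}\alpha_\sigma x_{\sigma(1)}\cdots x_{\sigma(m)}$ with $\alpha_\sigma\in K$. Its image on $M_n(K)$ is $Im(f)=\{f(b_1,\dots,b_m): b_1,\dots,b_m\in M_n(K)\}$. $sl_n(K)$ is the set of trace zero matrices in $M_n(K)$. The Vasilovsky grading is $M_n(K)=\bigoplus_{g\in\mathbb{Z}_n}A_g$, where $A_g$ is the span of the matrix units $E_{i,j}$ with $j-i\equiv g \pmod n$. A matrix $a$ is homogeneous of degree $g$, written $\deg(a)=g$, if $a\in A_g$. *)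

theory Defs
  imports
    "Jordan_Normal_Form.VS_Connect"
    "HOL-Library.Poly_Mapping"
    "HOL-Number_Theory.Cong"
    "HOL-Combinatorics.Permutations"
begin

text \<open>
  The free algebra \<open>K\<langle>X\<rangle>\<close> on \<open>X = {x\<^sub>i. i \<in> \<nat>}\<close> is the monoid algebra over \<open>K\<close> of the free
  monoid on \<open>X\<close>. The free monoid is a separate type, written additively, because the
  convolution product on \<^typ>\<open>'a \<Rightarrow>\<^sub>0 'b\<close> is built from the additive structure of the index type.
\<close>

datatype nc_word = Word (letters: "nat list")

instantiation nc_word :: monoid_add
begin

definition zero_nc_word :: nc_word where
  "zero_nc_word = Word []"

definition plus_nc_word :: "nc_word \<Rightarrow> nc_word \<Rightarrow> nc_word" where
  "plus_nc_word u v = Word (letters u @ letters v)"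

instance
  by standard (simp_all add: zero_nc_word_def plus_nc_word_def)

end

type_synonym 'k free_algebra = "nc_word \<Rightarrow>\<^sub>0 'k"

definition nc_var :: "nat \<Rightarrow> 'k::field free_algebra" where
  "nc_var i = Poly_Mapping.single (Word [i]) 1"

definition nc_const :: "'k::field \<Rightarrow> 'k free_algebra" where
  "nc_const c = Poly_Mapping.single 0 c"

definition multilinear :: "nat \<Rightarrow> 'k::field free_algebra \<Rightarrow> bool" where
  "multilinear m f \<longleftrightarrow>
    (\<exists>\<alpha>. f = (\<Sum>\<sigma> | \<sigma> permutes {1..m}.
              nc_const (\<alpha> \<sigma>) * prod_list (map (\<lambda>i. nc_var (\<sigma> i)) [1..<m + 1])))"

definition word_eval :: "nat \<Rightarrow> (nat \<Rightarrow> 'k::field mat) \<Rightarrow> nc_word \<Rightarrow> 'k mat" where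
  "word_eval n b w = foldr (*) (map b (letters w)) (1\<^sub>m n)"

definition nc_eval :: "nat \<Rightarrow> (nat \<Rightarrow> 'k::field mat) \<Rightarrow> 'k free_algebra \<Rightarrow> 'k mat" where
  "nc_eval n b f =
    finsum (module_mat TYPE('k) n n)
      (\<lambda>w. Poly_Mapping.lookup f w \<cdot>\<^sub>m word_eval n b w) (Poly_Mapping.keys f)"

text \<open>
  The values of \<open>b\<close> outside \<open>{1..m}\<close> are unconstrained; the image is meaningful for polynomials
  in \<open>x\<^sub>1, \<dots>, x\<^sub>m\<close> only.
\<close>

definition nc_image :: "nat \<Rightarrow> nat \<Rightarrow> 'k::field free_algebra \<Rightarrow> 'k mat set" where
  "nc_image n m f = {nc_eval n b f | b. \<forall>i\<in>{1..m}. b i \<in> carrier_mat n n}"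

definition scalar_mats :: "nat \<Rightarrow> 'k::field mat set" where
  "scalar_mats n = {c \<cdot>\<^sub>m 1\<^sub>m n | c. True}"

definition mat_trace :: "'k::field mat \<Rightarrow> 'k" where
  "mat_trace A = (\<Sum>i<dim_row A. A $$ (i, i))"

definition sl_mats :: "nat \<Rightarrow> 'k::field mat set" where
  "sl_mats n = {A \<in> carrier_mat n n. mat_trace A = 0}"

definition mat_unit :: "nat \<Rightarrow> nat \<Rightarrow> nat \<Rightarrow> 'k::field mat" where
  "mat_unit n i j = mat n n (\<lambda>(k, l). if k = i \<and> l = j then 1 else 0)"

text \<open>
  A degree in \<open>\<int>\<^sub>n\<close> is given by an arbitrary integer representative. Rows and columns are
  numbered from \<open>0\<close>, which does not affect \<open>j - i\<close>. The zero matrix lies in every component,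
  so a matrix is related to its degree by membership and not by a degree function.
\<close>

definition vasilovsky :: "nat \<Rightarrow> int \<Rightarrow> 'k::field mat set" where
  "vasilovsky n g =
    LinearCombinations.module.span class_ring (module_mat TYPE('k) n n)
      {mat_unit n i j | i j. i < n \<and> j < n \<and> [int j - int i = g] (mod int n)}"

end

theory Submission
  imports Defs
begin

text \<open>
  A product of matrices of degrees \<open>g\<^sub>1, \<dots>, g\<^sub>m\<close> has degree \<open>g\<^sub>1 + \<dots> + g\<^sub>m\<close>, and every word of a
  multilinear \<open>f\<close> uses each variable exactly once. So \<open>f\<close> takes homogeneous arguments of total
  degree \<open>g\<close> to a matrix of degree \<open>g\<close> (\<open>multilinear_eval_degree\<close>). In degree \<open>0\<close> the
  off-diagonal entries vanish; in every other degree the diagonal entries vanish. This gives both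
  implications from left to right: a scalar matrix with zero diagonal is zero, and the condition
  on traces is only a restriction of \<open>Im(f) \<subseteq> sl\<^sub>n(K)\<close> to some arguments.

  For the converses, compose \<open>f\<close> with a linear functional \<open>L\<close> on \<open>M\<^sub>n(K)\<close>. The result is additive
  in each argument, and every matrix is a sum of multiples of matrix units, which are homogeneous;
  hence \<open>L \<circ> f\<close> vanishes as soon as it vanishes on homogeneous arguments
  (\<open>multilinear_vanishes_if_on_homogeneous\<close>). For the second criterion \<open>L\<close> is the trace: the
  hypothesis covers total degree \<open>0\<close>, and the zero diagonal covers the other degrees. For the first
  one \<open>L\<close> is an off-diagonal entry: the hypothesis covers nonzero total degree, and in degree \<open>0\<close>
  the entry is zero anyway. All values of \<open>f\<close> are then diagonal. But the image of \<open>f\<close> is closed under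
  conjugation, and the only diagonal matrices whose conjugates are all diagonal are the scalar ones;
  conjugation by the transvections \<open>1 \<plusminus> E\<^sub>p\<^sub>q\<close> suffices to see this, over any field
  (\<open>multilinear_diagonal_imp_scalar\<close>).
\<close>

section \<open>Words of a multilinear polynomial\<close>

lemma prod_list_nc_var:
  "prod_list (map nc_var xs) = (Poly_Mapping.single (Word xs) 1 :: 'k::field free_algebra)"
proof (induction xs)
  case Nil
  have "(1 :: 'k free_algebra) = Poly_Mapping.single 0 1"
    by simp
  then show ?case
    by (simp add: zero_nc_word_def)
next
  case (Cons x xs)
  then show ?case
    by (simp add: nc_var_def mult_single plus_nc_word_def)
qed

text \<open>
  Values of \<open>f\<close> are linear combinations of values of its words, so each property of \<open>f\<close> is later
  checked word by word. Distinctness gives additivity in each argument; the set of letters makes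
  all words have the same total degree, whatever the order of their letters.
\<close>

lemma multilinear_keys:
  fixes f :: "'a::field free_algebra"
  assumes "multilinear m f" and "w \<in> Poly_Mapping.keys f"
  shows "distinct (letters w)" and "set (letters w) = {1..m}"
proof -
  obtain \<alpha> where f: "f = (\<Sum>\<sigma> | \<sigma> permutes {1..m}.
      nc_const (\<alpha> \<sigma>) * prod_list (map (\<lambda>i. nc_var (\<sigma> i)) [1..<m + 1]))"
    using assms(1) unfolding multilinear_def by blast
  have monomial: "nc_const (\<alpha> \<sigma>) * prod_list (map (\<lambda>i. nc_var (\<sigma> i)) [1..<m + 1])
      = Poly_Mapping.single (Word (map \<sigma> [1..<m + 1])) (\<alpha> \<sigma>)" for \<sigma>
  proof -
    have "map (\<lambda>i. nc_var (\<sigma> i)) [1..<m + 1] = (map nc_var (map \<sigma> [1..<m + 1]) :: 'a free_algebra list)"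
      by simp
    then show ?thesis
      by (simp only: prod_list_nc_var) (simp add: nc_const_def mult_single del: upt_Suc)
  qed
  obtain \<sigma> where \<sigma>: "\<sigma> permutes {1..m}" and w: "letters w = map \<sigma> [1..<m + 1]"
  proof -
    have "Poly_Mapping.keys f \<subseteq> (\<Union>\<sigma>\<in>{\<sigma>. \<sigma> permutes {1..m}}.
        Poly_Mapping.keys (Poly_Mapping.single (Word (map \<sigma> [1..<m + 1])) (\<alpha> \<sigma>)))"
      unfolding f monomial by (rule keys_sum)
    from subsetD[OF this assms(2)]
    obtain \<sigma> where "\<sigma> permutes {1..m}"
      and "w \<in> Poly_Mapping.keys (Poly_Mapping.single (Word (map \<sigma> [1..<m + 1])) (\<alpha> \<sigma>))"
      by (elim UN_E) simp
    then show thesis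
      using that[of \<sigma>] by (simp del: upt_Suc split: if_splits)
  qed
  have set: "set [1..<m + 1] = {1..m}"
    by auto
  show "distinct (letters w)"
    unfolding w using permutes_inj[OF \<sigma>] by (simp add: distinct_map inj_on_def del: upt_Suc)
  show "set (letters w) = {1..m}"
    unfolding w set_map set by (rule permutes_image[OF \<sigma>])
qed

section \<open>Values of words\<close>

lemma word_eval_Nil [simp]: "word_eval n b (Word []) = 1\<^sub>m n"
  by (simp add: word_eval_def)

lemma word_eval_Cons [simp]: "word_eval n b (Word (x # xs)) = b x * word_eval n b (Word xs)"
  by (simp add: word_eval_def)

lemma word_eval_carrier:
  assumes "\<forall>i\<in>set (letters w). b i \<in> carrier_mat n n"
  shows "word_eval n b w \<in> carrier_mat n n"
proof -
  have "\<forall>i\<in>set xs. b i \<in> carrier_mat n n \<Longrightarrow> word_eval n b (Word xs) \<in> carrier_mat n n" for xs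
    by (induction xs) auto
  then show ?thesis
    using assms by (metis nc_word.collapse)
qed

lemma word_eval_cong:
  assumes "\<And>i. i \<in> set (letters w) \<Longrightarrow> b i = c i"
  shows "word_eval n b w = word_eval n c w"
  unfolding word_eval_def using assms by (metis map_cong)

text \<open>
  Additivity in one argument needs that its variable occurs exactly once: the single factor
  \<open>A + B\<close> distributes over the product, and no other factor changes.
\<close>

lemma word_eval_additive:
  assumes "distinct (letters w)" and "i \<in> set (letters w)"
    and "\<forall>j\<in>set (letters w) - {i}. b j \<in> carrier_mat n n"
    and A: "A \<in> carrier_mat n n" and B: "B \<in> carrier_mat n n"
  shows "word_eval n (b(i := A + B)) w = word_eval n (b(i := A)) w + word_eval n (b(i := B)) w"
proof -
  have "word_eval n (b(i := A + B)) (Word xs)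
      = word_eval n (b(i := A)) (Word xs) + word_eval n (b(i := B)) (Word xs)"
    if "distinct xs" "i \<in> set xs" "\<forall>j\<in>set xs - {i}. b j \<in> carrier_mat n n" for xs
    using that
  proof (induction xs)
    case (Cons x xs)
    show ?case
    proof (cases "x = i")
      case True
      have rest: "word_eval n (b(i := C)) (Word xs) = word_eval n b (Word xs)" for C
        using Cons.prems True by (intro word_eval_cong) auto
      have "word_eval n b (Word xs) \<in> carrier_mat n n"
        using Cons.prems True by (intro word_eval_carrier) auto
      then show ?thesis
        using A B unfolding word_eval_Cons rest True fun_upd_same
        by (simp add: add_mult_distrib_mat)
    next
      case False
      have "word_eval n (b(i := C)) (Word xs) \<in> carrier_mat n n" if "C \<in> carrier_mat n n" for C
        using Cons.prems that False by (intro word_eval_carrier) auto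
      moreover have "b x \<in> carrier_mat n n"
        using Cons.prems False by simp
      ultimately show ?thesis
        using False Cons A B
        by (simp add: mult_add_distrib_mat[of _ n n _ n] fun_upd_other del: fun_upd_apply)
    qed
  qed simp
  then show ?thesis
    using assms by (metis nc_word.collapse)
qed

lemma word_eval_conjugate:
  assumes "\<forall>i\<in>set (letters w). b i \<in> carrier_mat n n"
    and P: "P \<in> carrier_mat n n" and Q: "Q \<in> carrier_mat n n"
    and PQ: "P * Q = 1\<^sub>m n" and QP: "Q * P = 1\<^sub>m n"
  shows "word_eval n (\<lambda>i. P * b i * Q) w = P * word_eval n b w * Q"
proof -
  have "word_eval n (\<lambda>i. P * b i * Q) (Word xs) = P * word_eval n b (Word xs) * Q"
    if "\<forall>i\<in>set xs. b i \<in> carrier_mat n n" for xs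
    using that
  proof (induction xs)
    case Nil
    then show ?case
      using P PQ by simp
  next
    case (Cons x xs)
    define W where "W = word_eval n b (Word xs)"
    have W: "W \<in> carrier_mat n n"
      unfolding W_def using Cons.prems by (intro word_eval_carrier) auto
    have x: "b x \<in> carrier_mat n n"
      using Cons.prems by simp
    have "P * b x * Q * (P * W * Q) = P * b x * (Q * P) * (W * Q)"
      using P Q W x by (simp add: assoc_mult_mat[of _ n n _ n _ n])
    also have "\<dots> = P * (b x * W) * Q"
      using P Q W x unfolding QP by (simp add: assoc_mult_mat[of _ n n _ n _ n])
    finally show ?case
      using Cons by (simp add: W_def)
  qed
  then show ?thesis
    using assms by (metis nc_word.collapse)
qed

text \<open>
  Membership in a homogeneous component is a condition on the support: the matrices supported on
  positions \<open>(p, q)\<close> with \<open>q - p \<equiv> g\<close> form a submodule that contains the spanning matrix units.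
\<close>

lemma vasilovsky_entry:
  fixes A :: "'a::field mat"
  assumes "A \<in> vasilovsky n g"
  shows "A \<in> carrier_mat n n"
    and "\<lbrakk>p < n; q < n; \<not> [int q - int p = g] (mod int n)\<rbrakk> \<Longrightarrow> A $$ (p, q) = 0"
proof -
  let ?V = "module_mat TYPE('a) n n"
  define N :: "'a mat set" where "N = {A \<in> carrier_mat n n.
    \<forall>p<n. \<forall>q<n. \<not> [int q - int p = g] (mod int n) \<longrightarrow> A $$ (p, q) = 0}"
  have N: "submodule class_ring N ?V"
  proof (rule submodule.intro)
    show "Module.module class_ring ?V"
      using matrix_vs[of n n] unfolding vectorspace_def by blast
  qed (auto simp: N_def module_mat_simps)
  have "vasilovsky n g \<subseteq> N"
    unfolding vasilovsky_def
    by (rule module.span_is_subset[OF submodule.module[OF N] _ N])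
      (auto simp: N_def mat_unit_def)
  then show "A \<in> carrier_mat n n"
    and "\<lbrakk>p < n; q < n; \<not> [int q - int p = g] (mod int n)\<rbrakk> \<Longrightarrow> A $$ (p, q) = 0"
    using assms by (auto simp: N_def)
qed

lemma smult_mat_unit_vasilovsky:
  fixes c :: "'a::field"
  assumes "p < n" and "q < n"
  shows "c \<cdot>\<^sub>m mat_unit n p q \<in> vasilovsky n (int q - int p)"
proof -
  let ?V = "module_mat TYPE('a) n n"
  let ?S = "{mat_unit n i j | i j. i < n \<and> j < n \<and>
    [int j - int i = int q - int p] (mod int n)} :: 'a mat set"
  have module: "Module.module class_ring ?V"
    using matrix_vs[of n n] unfolding vectorspace_def by blast
  have S: "?S \<subseteq> carrier ?V"
    by (auto simp: module_mat_simps mat_unit_def)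
  have "(mat_unit n p q :: 'a mat) \<in> vasilovsky n (int q - int p)"
    unfolding vasilovsky_def by (rule subsetD[OF module.in_own_span[OF module S]]) (use assms cong_refl in blast)
  then show ?thesis
    using submodule.smult_closed[OF module.span_is_submodule[OF module S], of c]
    by (simp add: vasilovsky_def module_mat_simps)
qed

text \<open>
  Degrees add up because the displacements of a path telescope: a product of entries along
  \<open>p, r, \<dots>, q\<close> can only be nonzero if the steps are congruent to the degrees of the factors, and
  then \<open>q - p\<close> is congruent to their sum.
\<close>

lemma word_eval_degree:
  assumes a: "\<forall>i\<in>set (letters w). a i \<in> vasilovsky n (g i)"
    and "p < n" and "q < n"
    and "\<not> [int q - int p = (\<Sum>i\<leftarrow>letters w. g i)] (mod int n)"
  shows "word_eval n a w $$ (p, q) = 0"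
proof -
  have "word_eval n a (Word xs) $$ (p, q) = 0"
    if "\<forall>i\<in>set xs. a i \<in> vasilovsky n (g i)" "p < n" "q < n"
      "\<not> [int q - int p = (\<Sum>i\<leftarrow>xs. g i)] (mod int n)" for xs p q
    using that
  proof (induction xs arbitrary: p)
    case Nil
    then show ?case
      by auto
  next
    case (Cons x xs)
    have x: "a x \<in> vasilovsky n (g x)"
      using Cons.prems by simp
    have W: "word_eval n a (Word xs) \<in> carrier_mat n n"
      using Cons.prems vasilovsky_entry(1) by (intro word_eval_carrier) auto
    have "a x $$ (p, r) * word_eval n a (Word xs) $$ (r, q) = 0" if r: "r < n" for r
    proof (cases "[int r - int p = g x] (mod int n)")
      case True
      have "\<not> [int q - int r = (\<Sum>i\<leftarrow>xs. g i)] (mod int n)"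
      proof
        assume "[int q - int r = (\<Sum>i\<leftarrow>xs. g i)] (mod int n)"
        from cong_add[OF True this] show False
          using Cons.prems(4) by (simp add: algebra_simps)
      qed
      then show ?thesis
        using Cons.IH[of r] Cons.prems r by simp
    next
      case False
      then show ?thesis
        using vasilovsky_entry(2)[OF x \<open>p < n\<close> r] by simp
    qed
    then have "(\<Sum>r = 0..<n. a x $$ (p, r) * word_eval n a (Word xs) $$ (r, q)) = 0"
      by (intro sum.neutral) auto
    then show ?case
      using vasilovsky_entry(1)[OF x] W Cons.prems
      by (simp add: times_mat_def scalar_prod_def)
  qed
  then show ?thesis
    using assms by (metis nc_word.collapse)
qed

section \<open>Linear functionals\<close>

text \<open>
  Entries, the trace and the entries of a conjugate are all linear functionals. Passing to them
  replaces the sum in the module of matrices that defines the evaluation by a sum in the field.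
\<close>

definition mat_functional :: "nat \<Rightarrow> ('k::field mat \<Rightarrow> 'k) \<Rightarrow> bool" where
  "mat_functional n L \<longleftrightarrow>
    (\<forall>A\<in>carrier_mat n n. \<forall>B\<in>carrier_mat n n. L (A + B) = L A + L B) \<and>
    (\<forall>c. \<forall>A\<in>carrier_mat n n. L (c \<cdot>\<^sub>m A) = c * L A)"

lemma mat_functional_zero:
  assumes "mat_functional n L"
  shows "L (0\<^sub>m n n) = 0"
proof -
  have "L (0 \<cdot>\<^sub>m 0\<^sub>m n n) = 0 * L (0\<^sub>m n n)"
    using assms zero_carrier_mat unfolding mat_functional_def by metis
  then show ?thesis
    by simp
qed

lemma mat_functional_entry:
  "p < n \<Longrightarrow> q < n \<Longrightarrow> mat_functional n (\<lambda>A. A $$ (p, q))"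
  by (auto simp: mat_functional_def)

lemma mat_functional_trace: "mat_functional n mat_trace"
  by (auto simp: mat_functional_def mat_trace_def sum.distrib sum_distrib_left)

lemma mat_functional_conjugate_entry:
  assumes "P \<in> carrier_mat n n" "Q \<in> carrier_mat n n" "p < n" "q < n"
  shows "mat_functional n (\<lambda>A. (P * A * Q) $$ (p, q))"
proof -
  have "(P * (A + B) * Q) $$ (p, q) = (P * A * Q) $$ (p, q) + (P * B * Q) $$ (p, q)"
    if "A \<in> carrier_mat n n" "B \<in> carrier_mat n n" for A B
  proof -
    have "P * (A + B) * Q = P * A * Q + P * B * Q"
      using that assms by (simp add: mult_add_distrib_mat[of _ n n] add_mult_distrib_mat[of _ n n])
    then show ?thesis
      using assms by (simp del: index_mult_mat(1))
  qed
  moreover have "(P * (c \<cdot>\<^sub>m A) * Q) $$ (p, q) = c * (P * A * Q) $$ (p, q)"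
    if "A \<in> carrier_mat n n" for c A
  proof -
    have "P * (c \<cdot>\<^sub>m A) * Q = c \<cdot>\<^sub>m (P * A * Q)"
      using that assms by (simp add: mult_smult_distrib[of _ n n] mult_smult_assoc_mat[of _ n n])
    then show ?thesis
      using assms by (simp del: index_mult_mat(1))
  qed
  ultimately show ?thesis
    unfolding mat_functional_def by blast
qed

lemma nc_eval_carrier_functional:
  assumes "\<And>w. w \<in> Poly_Mapping.keys f \<Longrightarrow> word_eval n b w \<in> carrier_mat n n"
  shows nc_eval_carrier: "nc_eval n b f \<in> carrier_mat n n"
    and nc_eval_functional: "mat_functional n L \<Longrightarrow>
      L (nc_eval n b f) = (\<Sum>w\<in>Poly_Mapping.keys f. Poly_Mapping.lookup f w * L (word_eval n b w))"
proof -
  interpret abelian_group "module_mat TYPE('a) n n"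
    by (rule abelian_group_mat)
  let ?s = "\<lambda>w. Poly_Mapping.lookup f w \<cdot>\<^sub>m word_eval n b w"
  let ?sum = "\<lambda>S. finsum (module_mat TYPE('a) n n) ?s S"
  have closed: "?sum S \<in> carrier_mat n n" if "S \<subseteq> Poly_Mapping.keys f" for S
    using finsum_closed[of ?s S] assms that by (simp add: module_mat_simps Pi_def subset_iff)
  then show "nc_eval n b f \<in> carrier_mat n n"
    by (simp add: nc_eval_def)
  assume L: "mat_functional n L"
  have "L (?sum S) = (\<Sum>w\<in>S. Poly_Mapping.lookup f w * L (word_eval n b w))"
    if "finite S" "S \<subseteq> Poly_Mapping.keys f" for S
    using that
  proof (induction S rule: finite_induct)
    case empty
    then show ?case
      using mat_functional_zero[OF L] by (simp add: module_mat_simps)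
  next
    case (insert w S)
    have "?sum (insert w S) = ?s w + ?sum S"
      using finsum_insert[of S w ?s] insert.hyps insert.prems assms
      by (simp add: module_mat_simps Pi_def subset_iff)
    then show ?case
      using L insert assms[of w] closed[of S] by (simp add: mat_functional_def)
  qed
  then show "L (nc_eval n b f)
      = (\<Sum>w\<in>Poly_Mapping.keys f. Poly_Mapping.lookup f w * L (word_eval n b w))"
    by (simp add: nc_eval_def)
qed

section \<open>Values of a multilinear polynomial\<close>

context
  fixes f :: "'k::field free_algebra" and n m :: nat
  assumes multilinear: "multilinear m f"
begin

lemma multilinear_word_eval_carrier:
  assumes "\<forall>i\<in>{1..m}. b i \<in> carrier_mat n n" and "w \<in> Poly_Mapping.keys f"
  shows "word_eval n b w \<in> carrier_mat n n"
  using assms multilinear_keys(2)[OF multilinear assms(2)] by (intro word_eval_carrier) simp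

lemma multilinear_eval_carrier:
  assumes "\<forall>i\<in>{1..m}. b i \<in> carrier_mat n n"
  shows "nc_eval n b f \<in> carrier_mat n n"
  using nc_eval_carrier multilinear_word_eval_carrier[OF assms] by blast

lemma multilinear_eval_functional:
  assumes "\<forall>i\<in>{1..m}. b i \<in> carrier_mat n n" and "mat_functional n L"
  shows "L (nc_eval n b f)
    = (\<Sum>w\<in>Poly_Mapping.keys f. Poly_Mapping.lookup f w * L (word_eval n b w))"
  by (rule nc_eval_functional[OF multilinear_word_eval_carrier[OF assms(1)] assms(2)])

lemma multilinear_eval_additive:
  assumes b: "\<forall>j\<in>{1..m} - {i}. b j \<in> carrier_mat n n" and i: "i \<in> {1..m}"
    and A: "A \<in> carrier_mat n n" and B: "B \<in> carrier_mat n n" and L: "mat_functional n L"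
  shows "L (nc_eval n (b(i := A + B)) f)
    = L (nc_eval n (b(i := A)) f) + L (nc_eval n (b(i := B)) f)"
proof -
  have slot: "\<forall>j\<in>{1..m}. (b(i := C)) j \<in> carrier_mat n n" if "C \<in> carrier_mat n n" for C
    using b that by auto
  have expand: "L (nc_eval n (b(i := C)) f)
      = (\<Sum>w\<in>Poly_Mapping.keys f. Poly_Mapping.lookup f w * L (word_eval n (b(i := C)) w))"
    if "C \<in> carrier_mat n n" for C
    by (rule multilinear_eval_functional[OF slot[OF that] L])
  have "L (word_eval n (b(i := A + B)) w)
      = L (word_eval n (b(i := A)) w) + L (word_eval n (b(i := B)) w)"
    if w: "w \<in> Poly_Mapping.keys f" for w
  proof -
    have "word_eval n (b(i := A + B)) w = word_eval n (b(i := A)) w + word_eval n (b(i := B)) w"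
      using multilinear_keys[OF multilinear w] b i A B by (intro word_eval_additive) auto
    then show ?thesis
      using L multilinear_word_eval_carrier[OF slot[OF A] w]
        multilinear_word_eval_carrier[OF slot[OF B] w]
      by (simp add: mat_functional_def del: fun_upd_apply)
  qed
  then show ?thesis
    using A B by (simp add: expand distrib_left sum.distrib)
qed

lemma multilinear_eval_conjugate:
  assumes b: "\<forall>i\<in>{1..m}. b i \<in> carrier_mat n n"
    and P: "P \<in> carrier_mat n n" and Q: "Q \<in> carrier_mat n n"
    and PQ: "P * Q = 1\<^sub>m n" and QP: "Q * P = 1\<^sub>m n"
  shows "nc_eval n (\<lambda>i. P * b i * Q) f = P * nc_eval n b f * Q"
proof -
  have c: "\<forall>i\<in>{1..m}. P * b i * Q \<in> carrier_mat n n"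
    using b P Q by auto
  have word: "word_eval n (\<lambda>i. P * b i * Q) w = P * word_eval n b w * Q"
    if "w \<in> Poly_Mapping.keys f" for w
    using b P Q PQ QP multilinear_keys(2)[OF multilinear that]
    by (intro word_eval_conjugate) auto
  have "nc_eval n (\<lambda>i. P * b i * Q) f $$ (p, q) = (P * nc_eval n b f * Q) $$ (p, q)"
    if "p < n" "q < n" for p q
    using multilinear_eval_functional[OF c mat_functional_entry[OF that]]
      multilinear_eval_functional[OF b mat_functional_conjugate_entry[OF P Q that]]
    by (simp add: word)
  moreover have "nc_eval n (\<lambda>i. P * b i * Q) f \<in> carrier_mat n n"
    and "P * nc_eval n b f * Q \<in> carrier_mat n n"
    using multilinear_eval_carrier[OF c] multilinear_eval_carrier[OF b] P Q by auto
  ultimately show ?thesis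
    by (intro eq_matI) (auto simp del: index_mult_mat)
qed

lemma multilinear_eval_degree:
  assumes a: "\<forall>i\<in>{1..m}. a i \<in> vasilovsky n (g i)" and "p < n" and "q < n"
    and deg: "\<not> [int q - int p = (\<Sum>i=1..m. g i)] (mod int n)"
  shows "nc_eval n a f $$ (p, q) = 0"
proof -
  have "word_eval n a w $$ (p, q) = 0" if w: "w \<in> Poly_Mapping.keys f" for w
  proof -
    have "(\<Sum>i\<leftarrow>letters w. g i) = (\<Sum>i=1..m. g i)"
      using multilinear_keys[OF multilinear w] by (simp add: sum_list_distinct_conv_sum_set)
    then show ?thesis
      using a deg multilinear_keys(2)[OF multilinear w] \<open>p < n\<close> \<open>q < n\<close>
      by (intro word_eval_degree[where g = g]) auto
  qed
  moreover have "\<forall>i\<in>{1..m}. a i \<in> carrier_mat n n"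
    using a vasilovsky_entry(1) by blast
  ultimately show ?thesis
    using multilinear_eval_functional[OF _ mat_functional_entry[OF \<open>p < n\<close> \<open>q < n\<close>]] by simp
qed

end

section \<open>Reduction to homogeneous arguments\<close>

text \<open>
  The support is enlarged by one position at a time, so that additivity for two summands suffices.
\<close>

lemma additive_vanishes_if_on_units:
  fixes F :: "'k::field mat \<Rightarrow> 'k"
  assumes additive: "\<And>A B. A \<in> carrier_mat n n \<Longrightarrow> B \<in> carrier_mat n n \<Longrightarrow> F (A + B) = F A + F B"
    and units: "\<And>c p q. p < n \<Longrightarrow> q < n \<Longrightarrow> F (c \<cdot>\<^sub>m mat_unit n p q) = 0"
    and A: "A \<in> carrier_mat n n"
  shows "F A = 0"
proof -
  define R where "R S = mat n n (\<lambda>pq. if pq \<in> S then A $$ pq else 0)" for S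
  have zero: "F (0\<^sub>m n n) = 0"
  proof -
    have "F (0\<^sub>m n n) + F (0\<^sub>m n n) = F (0\<^sub>m n n) + 0"
      using additive[of "0\<^sub>m n n" "0\<^sub>m n n"] by simp
    then show ?thesis
      by (rule add_left_imp_eq)
  qed
  have "F (R S) = 0" if "finite S" "S \<subseteq> {..<n} \<times> {..<n}" for S
    using that
  proof (induction S rule: finite_induct)
    case empty
    have "R {} = 0\<^sub>m n n"
      by (auto simp: R_def)
    then show ?case
      using zero by simp
  next
    case (insert x S)
    obtain p q where x: "x = (p, q)"
      by fastforce
    have split: "R (insert x S) = R S + A $$ (p, q) \<cdot>\<^sub>m mat_unit n p q"
      using insert by (intro eq_matI) (auto simp: R_def x mat_unit_def)
    have "F (R (insert x S)) = F (R S) + F (A $$ (p, q) \<cdot>\<^sub>m mat_unit n p q)"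
      unfolding split by (rule additive) (auto simp: R_def mat_unit_def)
    then show ?case
      using insert units x by auto
  qed
  moreover have "R ({..<n} \<times> {..<n}) = A"
    using A by (auto simp: R_def)
  ultimately show ?thesis
    by (metis finite_SigmaI finite_lessThan order_refl)
qed

text \<open>
  The arguments are made homogeneous one at a time, by induction on the set \<open>S\<close> of indices of the
  arguments that need not be homogeneous: with all other arguments held fixed, the value is
  additive in \<open>b\<^sub>i\<close>, and a multiple of a matrix unit in place of \<open>b\<^sub>i\<close> removes \<open>i\<close> from \<open>S\<close>.
\<close>

lemma multilinear_vanishes_if_on_homogeneous:
  fixes f :: "'k::field free_algebra"
  assumes f: "multilinear m f" and L: "mat_functional n L"
    and hom: "\<And>a g. \<forall>i\<in>{1..m}. a i \<in> vasilovsky n (g i) \<Longrightarrow> L (nc_eval n a f) = 0"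
    and b: "\<forall>i\<in>{1..m}. b i \<in> carrier_mat n n"
  shows "L (nc_eval n b f) = 0"
proof -
  have "L (nc_eval n b f) = 0"
    if "finite S" "S \<subseteq> {1..m}" "\<forall>i\<in>{1..m}. b i \<in> carrier_mat n n"
      "\<forall>i\<in>{1..m} - S. \<exists>g. b i \<in> vasilovsky n g" for S b
    using that
  proof (induction S arbitrary: b rule: finite_induct)
    case empty
    then obtain g where "\<forall>i\<in>{1..m}. b i \<in> vasilovsky n (g i)"
      by (metis Diff_empty)
    then show ?case
      by (rule hom)
  next
    case (insert i S)
    have i: "i \<in> {1..m}" and S: "S \<subseteq> {1..m}"
      using insert.prems by auto
    have "L (nc_eval n (b(i := b i)) f) = 0"
    proof (rule additive_vanishes_if_on_units[where F = "\<lambda>A. L (nc_eval n (b(i := A)) f)"])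
      show "L (nc_eval n (b(i := A + B)) f)
          = L (nc_eval n (b(i := A)) f) + L (nc_eval n (b(i := B)) f)"
        if "A \<in> carrier_mat n n" "B \<in> carrier_mat n n" for A B
        using insert.prems i that L by (intro multilinear_eval_additive[OF f]) auto
      show "L (nc_eval n (b(i := c \<cdot>\<^sub>m mat_unit n p q)) f) = 0" if "p < n" "q < n" for c p q
      proof (rule insert.IH[OF S])
        note unit = smult_mat_unit_vasilovsky[OF that, of c]
        show "\<forall>j\<in>{1..m}. (b(i := c \<cdot>\<^sub>m mat_unit n p q)) j \<in> carrier_mat n n"
          using insert.prems vasilovsky_entry(1)[OF unit] by auto
        show "\<forall>j\<in>{1..m} - S. \<exists>g. (b(i := c \<cdot>\<^sub>m mat_unit n p q)) j \<in> vasilovsky n g"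
          using insert.prems unit by auto
      qed
      show "b i \<in> carrier_mat n n"
        using insert.prems i by blast
    qed
    then show ?case
      by simp
  qed
  from this[of "{1..m}" b] show ?thesis
    using b by simp
qed

lemma off_diagonal_degree:
  assumes "p < n" and "q < n" and "p \<noteq> q"
  shows "\<not> [int q - int p = 0] (mod int n)"
proof
  assume "[int q - int p = 0] (mod int n)"
  then have "[int q = int p] (mod int n)"
    by (simp add: cong_iff_dvd_diff)
  then show False
    using assms by (simp add: cong_int_iff cong_def)
qed

section \<open>From diagonal to scalar values\<close>

text \<open>
  If \<open>D\<close> is diagonal then the \<open>(p, q)\<close> entry of \<open>(1 - E\<^sub>p\<^sub>q) D (1 + E\<^sub>p\<^sub>q)\<close> is \<open>D\<^sub>p\<^sub>p - D\<^sub>q\<^sub>q\<close>. For a value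
  \<open>D\<close> of \<open>f\<close> this conjugate is again a value of \<open>f\<close>, hence diagonal, so the two entries agree.
\<close>

lemma multilinear_diagonal_imp_scalar:
  fixes f :: "'k::field free_algebra"
  assumes f: "multilinear m f" and "n \<ge> 1"
    and diag: "\<And>b p q. \<forall>i\<in>{1..m}. b i \<in> carrier_mat n n \<Longrightarrow> p < n \<Longrightarrow> q < n \<Longrightarrow> p \<noteq> q \<Longrightarrow>
      nc_eval n b f $$ (p, q) = 0"
    and b: "\<forall>i\<in>{1..m}. b i \<in> carrier_mat n n"
  shows "nc_eval n b f \<in> scalar_mats n"
proof -
  define D where "D = nc_eval n b f"
  have D: "D \<in> carrier_mat n n"
    unfolding D_def by (rule multilinear_eval_carrier[OF f b])
  have equal: "D $$ (p, p) = D $$ (q, q)" if pq: "p < n" "q < n" "p \<noteq> q" for p q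
  proof -
    \<comment> \<open>Adding column \<open>p\<close> to column \<open>q\<close> and subtracting row \<open>q\<close> from row \<open>p\<close> is the conjugation.\<close>
    obtain P Q where "similar_mat_wit (add_col_sub_row 1 p q D) D P Q"
      using add_col_sub_row_similar[OF D pq] unfolding similar_mat_def by blast
    moreover have "add_col_sub_row 1 p q D \<in> carrier_mat n n"
      using D by simp
    ultimately have P: "P \<in> carrier_mat n n" and Q: "Q \<in> carrier_mat n n"
      and inverse: "P * Q = 1\<^sub>m n" "Q * P = 1\<^sub>m n"
      and conj: "add_col_sub_row 1 p q D = P * D * Q"
      by (auto dest: similar_mat_witD2)
    have c: "\<forall>i\<in>{1..m}. P * b i * Q \<in> carrier_mat n n"
      using b P Q by auto
    have "P * D * Q = nc_eval n (\<lambda>i. P * b i * Q) f"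
      unfolding D_def using multilinear_eval_conjugate[OF f b P Q inverse] by simp
    then have "add_col_sub_row 1 p q D $$ (p, q) = 0"
      unfolding conj using diag[OF c pq] by simp
    moreover have "D $$ (p, q) = 0" "D $$ (q, p) = 0"
      unfolding D_def using diag[OF b] pq by auto
    ultimately show ?thesis
      using D pq by simp
  qed
  have "D = D $$ (0, 0) \<cdot>\<^sub>m 1\<^sub>m n"
  proof (rule eq_matI)
    fix p q
    assume "p < dim_row (D $$ (0, 0) \<cdot>\<^sub>m 1\<^sub>m n)" "q < dim_col (D $$ (0, 0) \<cdot>\<^sub>m 1\<^sub>m n)"
    then have pq: "p < n" "q < n"
      by auto
    show "D $$ (p, q) = (D $$ (0, 0) \<cdot>\<^sub>m 1\<^sub>m n) $$ (p, q)"
    proof (cases "p = q")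
      case True
      then show ?thesis
        using pq equal[of p 0] by (cases "p = 0") auto
    next
      case False
      then show ?thesis
        using pq diag[OF b pq] by (simp add: D_def)
    qed
  qed (use D in auto)
  then show ?thesis
    unfolding scalar_mats_def D_def by blast
qed

section \<open>The two criteria\<close>

theorem lemma4p1:
  fixes f :: "'k::field free_algebra" and n m :: nat
  assumes "n \<ge> 1" and "m \<ge> 1" and "multilinear m f"
  shows "(nc_image n m f \<subseteq> scalar_mats n \<longleftrightarrow>
           (\<forall>(a :: nat \<Rightarrow> 'k mat) (g :: nat \<Rightarrow> int).
              (\<forall>i\<in>{1..m}. a i \<in> vasilovsky n (g i)) \<longrightarrow>
              \<not> [(\<Sum>i=1..m. g i) = 0] (mod int n) \<longrightarrow>
              nc_eval n a f = 0\<^sub>m n n)) \<and>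
         (nc_image n m f \<subseteq> sl_mats n \<longleftrightarrow>
           (\<forall>(a :: nat \<Rightarrow> 'k mat) (g :: nat \<Rightarrow> int).
              (\<forall>i\<in>{1..m}. a i \<in> vasilovsky n (g i)) \<longrightarrow>
              [(\<Sum>i=1..m. g i) = 0] (mod int n) \<longrightarrow>
              mat_trace (nc_eval n a f) = 0))"
proof (intro conjI iffI allI impI)
  note f = \<open>multilinear m f\<close>
  have image: "nc_eval n a f \<in> nc_image n m f" if "\<forall>i\<in>{1..m}. a i \<in> vasilovsky n (g i)" for a :: "nat \<Rightarrow> 'k mat" and g
    using that vasilovsky_entry(1) unfolding nc_image_def by blast
  have diagonal_zero: "nc_eval n a f $$ (p, p) = 0"
    if "\<forall>i\<in>{1..m}. a i \<in> vasilovsky n (g i)" "\<not> [(\<Sum>i=1..m. g i) = 0] (mod int n)" "p < n" for a :: "nat \<Rightarrow> 'k mat" and g p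
    using multilinear_eval_degree[OF f that(1) that(3) that(3)] that(2) by (simp add: cong_sym_eq)
  show "nc_eval n a f = 0\<^sub>m n n"
    if scalar: "nc_image n m f \<subseteq> scalar_mats n" and a: "\<forall>i\<in>{1..m}. a i \<in> vasilovsky n (g i)"
      and g: "\<not> [(\<Sum>i=1..m. g i) = 0] (mod int n)" for a :: "nat \<Rightarrow> 'k mat" and g
  proof -
    obtain c where c: "nc_eval n a f = c \<cdot>\<^sub>m 1\<^sub>m n"
      using image[OF a] scalar unfolding scalar_mats_def by blast
    have "c = 0"
      using diagonal_zero[OF a g, of 0] \<open>n \<ge> 1\<close> by (simp add: c)
    then show ?thesis
      unfolding c by auto
  qed
  show "nc_image n m f \<subseteq> scalar_mats n"
    if van: "\<forall>(a :: nat \<Rightarrow> 'k mat) g. (\<forall>i\<in>{1..m}. a i \<in> vasilovsky n (g i)) \<longrightarrow>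
      \<not> [(\<Sum>i=1..m. g i) = 0] (mod int n) \<longrightarrow> nc_eval n a f = 0\<^sub>m n n"
  proof -
    have "nc_eval n b f $$ (p, q) = 0"
      if b: "\<forall>i\<in>{1..m}. b i \<in> carrier_mat n n" and pq: "p < n" "q < n" "p \<noteq> q" for b p q
    proof (rule multilinear_vanishes_if_on_homogeneous[OF f mat_functional_entry[OF pq(1,2)] _ b])
      fix a :: "nat \<Rightarrow> 'k mat" and g
      assume a: "\<forall>i\<in>{1..m}. a i \<in> vasilovsky n (g i)"
      show "nc_eval n a f $$ (p, q) = 0"
      proof (cases "[(\<Sum>i=1..m. g i) = 0] (mod int n)")
        case True
        then have "\<not> [int q - int p = (\<Sum>i=1..m. g i)] (mod int n)"
          using off_diagonal_degree[OF pq] cong_trans by blast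
        then show ?thesis
          by (rule multilinear_eval_degree[OF f a pq(1,2)])
      next
        case False
        then show ?thesis
          using van a pq by simp
      qed
    qed
    then show ?thesis
      using multilinear_diagonal_imp_scalar[OF f \<open>n \<ge> 1\<close>] unfolding nc_image_def by blast
  qed
  show "mat_trace (nc_eval n a f) = 0"
    if "nc_image n m f \<subseteq> sl_mats n" "\<forall>i\<in>{1..m}. a i \<in> vasilovsky n (g i)" for a :: "nat \<Rightarrow> 'k mat" and g
    using image[OF that(2)] that(1) unfolding sl_mats_def by blast
  show "nc_image n m f \<subseteq> sl_mats n"
    if van: "\<forall>(a :: nat \<Rightarrow> 'k mat) g. (\<forall>i\<in>{1..m}. a i \<in> vasilovsky n (g i)) \<longrightarrow>
      [(\<Sum>i=1..m. g i) = 0] (mod int n) \<longrightarrow> mat_trace (nc_eval n a f) = 0"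
  proof -
    have "mat_trace (nc_eval n b f) = 0" if b: "\<forall>i\<in>{1..m}. b i \<in> carrier_mat n n" for b
    proof (rule multilinear_vanishes_if_on_homogeneous[OF f mat_functional_trace _ b])
      fix a :: "nat \<Rightarrow> 'k mat" and g
      assume a: "\<forall>i\<in>{1..m}. a i \<in> vasilovsky n (g i)"
      show "mat_trace (nc_eval n a f) = 0"
      proof (cases "[(\<Sum>i=1..m. g i) = 0] (mod int n)")
        case True
        then show ?thesis
          using van a by blast
      next
        case False
        have "nc_eval n a f \<in> carrier_mat n n"
          using a multilinear_eval_carrier[OF f] vasilovsky_entry(1) by blast
        then show ?thesis
          using diagonal_zero[OF a False] by (simp add: mat_trace_def)
      qed
    qed
    then show ?thesis
      using multilinear_eval_carrier[OF f] unfolding nc_image_def sl_mats_def by blast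
  qed
qed

end
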